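(* There exist constants $C_1>0$ and $C_2>0$ such that: (i) For all $0<\varepsilon<1$, if $0<r<1$ and $r>1-C_1\sqrt{\varepsilon}$, then $ds^*$ has a conformal completion $ds_\varepsilon$ in $B_r$ whose Gaussian curvature satisfies $$-(1+\varepsilon)<\kappa(ds_\varepsilon)<-\frac{1}{1+\varepsilon}.$$ (ii) For all sufficiently small $\varepsilon>0$, if $0<r<1$ and $ds^*$ has a conformal completion $ds_\varepsilon$ in $B_r$ whose Gaussian curvature satisfies $$\kappa(ds_\varepsilon)<-\frac{1}{1+\varepsilon},$$ then $r>1-C_2\sqrt{\varepsilon}$.
   Context: $\mathbb{D}=\{z\in\mathbb{C}: |z|<1\}$ and $\mathbb{D}^*=\{z\in\mathbb{C}: 0<|z|<1\}$. The metric $ds^*=-\frac{1}{|z|\log|z|}\,|dz|$ is the complete hyperbolic (curvature $-1$) metric on $\mathbb{D}^*$ conformally equivalent to the Euclidean metric. For $0<r<1$, $B_r=\{z: 0<|z|<r\}$. A conformal completion of $ds^*$ in $B_r$ is a Riemannian metric $ds=e^{u}|dz|$ on all of $\mathbb{D}$, with $u$ a real function of class $C^2$ on $\mathbb{D}$ (including at $0$), such that $ds=ds^*$ on $\{r\le|z|<1\}$. $\kappa(ds)$ denotes its Gaussian curvature; the inequalities are required at every point of $\mathbb{D}$. *)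

theory Defs
  imports "HOL-Analysis.Analysis"
begin

definition C2_on :: "('a::real_normed_vector \<Rightarrow> real) \<Rightarrow> 'a set \<Rightarrow> bool" where
  "C2_on u S \<longleftrightarrow>
    (\<exists>(u' :: 'a \<Rightarrow> 'a \<Rightarrow>\<^sub>L real) (u'' :: 'a \<Rightarrow> 'a \<Rightarrow>\<^sub>L 'a \<Rightarrow>\<^sub>L real).
      (\<forall>z\<in>S. (u has_derivative blinfun_apply (u' z)) (at z)) \<and>
      (\<forall>z\<in>S. (u' has_derivative blinfun_apply (u'' z)) (at z)) \<and>
      continuous_on S u'')"

definition dir_deriv :: "'a::real_normed_vector \<Rightarrow> ('a \<Rightarrow> real) \<Rightarrow> 'a \<Rightarrow> real" where
  "dir_deriv b u z = deriv (\<lambda>t::real. u (z + t *\<^sub>R b)) 0"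

definition laplacian :: "('a::euclidean_space \<Rightarrow> real) \<Rightarrow> 'a \<Rightarrow> real" where
  "laplacian u z = (\<Sum>b\<in>Basis. dir_deriv b (dir_deriv b u) z)"

(* A metric conformal to the Euclidean one, ds = \<rho> |dz| with \<rho> > 0, is represented by its
   density \<rho>.  For \<rho> = e^u the Gaussian curvature below reads - e^(-2u) \<Delta>u. *)

definition gauss_curvature :: "(complex \<Rightarrow> real) \<Rightarrow> complex \<Rightarrow> real" where
  "gauss_curvature \<rho> z = - laplacian (\<lambda>w. ln (\<rho> w)) z / (\<rho> z)\<^sup>2"

(* Density of the complete hyperbolic metric on 0 < |z| < 1; meaningful only there. *)

definition hyp_density :: "complex \<Rightarrow> real" where
  "hyp_density z = - 1 / (norm z * ln (norm z))"

definition conformal_completion :: "real \<Rightarrow> (complex \<Rightarrow> real) \<Rightarrow> bool" where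
  "conformal_completion r \<rho> \<longleftrightarrow>
    (\<exists>u. C2_on u (ball 0 1) \<and> (\<forall>z\<in>ball 0 1. \<rho> z = exp (u z))) \<and>
    (\<forall>z. r \<le> norm z \<and> norm z < 1 \<longrightarrow> \<rho> z = hyp_density z)"

end

theory Submission
  imports Defs
begin

text \<open>
  The price of closing the cusp is visible in the coordinate \<open>s = - ln \<bar>z\<bar>\<close>. Write a rotationally
  symmetric metric as \<open>\<bar>dz\<bar> / (\<bar>z\<bar> * g s)\<close>. The cusp metric has \<open>g s = s\<close>, the hyperbolic metric of the
  disc has \<open>g s = sinh s\<close>, and the curvature is \<open>- (g'\<^sup>2 - g * g'')\<close> (lemma
  \<open>laplacian_cylindrical_log_density\<close>). Put \<open>a = - ln r\<close>, which is comparable to \<open>1 - r\<close> when \<open>r\<close> is near 1.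
  The two profiles agree up to \<open>s ^ 3\<close>, so passing from one to the other on the scale \<open>a\<close> costs curvature
  of order \<open>a\<^sup>2\<close>; the comparison in part (ii) shows that no smaller order will do.

  Part (i). A \<open>C\<^sup>2\<close> cutoff blends \<open>s\<close> for \<open>s \<le> a\<close> into \<open>sinh s\<close> for \<open>s \<ge> 2 * a\<close>. The result is the
  hyperbolic disc metric around the origin, hence smooth there, and its curvature differs from \<open>- 1\<close>
  by at most \<open>1000 * a\<^sup>2\<close> (lemmas \<open>interpolating_profile\<close> and \<open>exists_completion\<close>).

  Part (ii). Suppose that the curvature is at most \<open>- k\<close>, with \<open>k = 1 / (1 + \<epsilon>)\<close>. The comparison is with the
  metric of constant curvature \<open>- k\<close> on a disc of radius \<open>R > r\<close>, where \<open>R\<close> is chosen so that it agrees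
  with the cusp metric on \<open>\<bar>z\<bar> = r\<close>. By the maximum principle (the Ahlfors-Schwarz argument) the
  completion lies below it in \<open>\<bar>z\<bar> \<le> r\<close>. As the two agree at \<open>r\<close>, the radial derivative of the cusp
  metric at \<open>r\<close> is at least that of the comparison metric. Both are explicit, and the inequality says
  \<open>k + a\<^sup>2 \<le> 1\<close> (lemma \<open>completion_radius_bound\<close>).
\<close>

section \<open>Functions of class \<open>C\<^sup>2\<close> and their Laplacian\<close>

lemma has_real_derivative_along_line:
  assumes "(u has_derivative D) (at (z + t *\<^sub>R b))"
  shows "((\<lambda>t. u (z + t *\<^sub>R b)) has_real_derivative D b) (at t)"
proof -
  have "((\<lambda>t. z + t *\<^sub>R b) has_derivative (\<lambda>h. h *\<^sub>R b)) (at t)"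
    by (auto intro!: derivative_eq_intros)
  from has_derivative_compose[OF this assms]
  have "((\<lambda>t. u (z + t *\<^sub>R b)) has_derivative (\<lambda>h. D (h *\<^sub>R b))) (at t)" .
  moreover have "D (h *\<^sub>R b) = D b * h" for h
    using has_derivative_linear[OF assms] by (simp add: linear_cmul)
  ultimately show ?thesis
    by (simp add: has_field_derivative_def)
qed

lemma dir_deriv_eq:
  assumes "(u has_derivative D) (at z)"
  shows "dir_deriv b u z = D b"
  unfolding dir_deriv_def
  by (rule DERIV_imp_deriv, rule has_real_derivative_along_line) (use assms in simp)

lemma eventually_along_line_in_open:
  fixes z :: "'a::real_normed_vector"
  assumes "open S" "z \<in> S"
  shows "eventually (\<lambda>t::real. z + t *\<^sub>R b \<in> S) (nhds 0)"
proof -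
  have "((\<lambda>t::real. z + t *\<^sub>R b) \<longlongrightarrow> z + 0 *\<^sub>R b) (nhds 0)"
    by (intro tendsto_intros) (simp add: filterlim_ident)
  from topological_tendstoD[OF this assms(1)] assms(2) show ?thesis by simp
qed

lemma dir_deriv_cong:
  assumes "open S" "z \<in> S" "\<And>y. y \<in> S \<Longrightarrow> u y = v y"
  shows "dir_deriv b u z = dir_deriv b v z"
  unfolding dir_deriv_def
  by (rule deriv_cong_ev, rule eventually_mono[OF eventually_along_line_in_open[OF assms(1,2)]])
     (auto intro: assms)

text \<open>The Laplacian depends only on the germ of the function, so it may be computed from a local formula.\<close>
lemma laplacian_cong:
  assumes "open S" "z \<in> S" "\<And>y. y \<in> S \<Longrightarrow> u y = v y"
  shows "laplacian u z = laplacian v z"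
  unfolding laplacian_def
  by (intro sum.cong refl dir_deriv_cong[OF assms(1,2)] dir_deriv_cong[OF assms(1)] assms(3))

lemma laplacian_eq_trace:
  assumes "open S" "z \<in> S"
    and "\<And>y. y \<in> S \<Longrightarrow> (u has_derivative blinfun_apply (u' y)) (at y)"
    and "(u' has_derivative blinfun_apply u'') (at z)"
  shows "laplacian u z = (\<Sum>b\<in>Basis. u'' b b)"
proof -
  have "dir_deriv b (dir_deriv b u) z = u'' b b" for b
  proof -
    have "dir_deriv b (dir_deriv b u) z = dir_deriv b (\<lambda>y. u' y b) z"
      by (rule dir_deriv_cong[OF assms(1,2)]) (rule dir_deriv_eq[OF assms(3)])
    also have "\<dots> = u'' b b"
      by (rule dir_deriv_eq) (intro bounded_linear.has_derivative[OF bounded_linear_blinfun_apply]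
          derivative_intros assms(4) bounded_linear.has_derivative[OF blinfun.bounded_linear_left])
    finally show ?thesis .
  qed
  then show ?thesis by (simp add: laplacian_def)
qed

lemma C2_on_subset: "C2_on u S \<Longrightarrow> T \<subseteq> S \<Longrightarrow> C2_on u T"
  unfolding C2_on_def by (meson continuous_on_subset subsetD)

lemma C2_on_imp_continuous_on: "C2_on u S \<Longrightarrow> continuous_on S u"
  unfolding C2_on_def 
  by (meson continuous_at_imp_continuous_on has_derivative_continuous)

lemma C2_on_cong:
  assumes "open S" "\<And>z. z \<in> S \<Longrightarrow> u z = v z" "C2_on u S"
  shows "C2_on v S"
  using assms unfolding C2_on_def
  by (metis has_derivative_transform_within_open)

text \<open>The derivatives given on the two open sets agree on the overlap by uniqueness, so they glue. This lets a
  completion be checked separately near the origin, where \<open>- ln \<bar>z\<bar>\<close> is singular, and away from it.\<close>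
lemma C2_on_Un:
  assumes "open S" "open T" "C2_on u S" "C2_on u T"
  shows "C2_on u (S \<union> T)"
proof -
  obtain a' a'' where a: "\<And>z. z \<in> S \<Longrightarrow> (u has_derivative blinfun_apply (a' z)) (at z)"
      "\<And>z. z \<in> S \<Longrightarrow> (a' has_derivative blinfun_apply (a'' z)) (at z)" "continuous_on S a''"
    using assms(3) unfolding C2_on_def by blast
  obtain b' b'' where b: "\<And>z. z \<in> T \<Longrightarrow> (u has_derivative blinfun_apply (b' z)) (at z)"
      "\<And>z. z \<in> T \<Longrightarrow> (b' has_derivative blinfun_apply (b'' z)) (at z)" "continuous_on T b''"
    using assms(4) unfolding C2_on_def by blast
  have ab': "a' z = b' z" if "z \<in> S \<inter> T" for z
    using has_derivative_unique[OF a(1) b(1)] that by (auto simp: blinfun_apply_inject)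
  have ab'': "a'' z = b'' z" if "z \<in> S \<inter> T" for z
  proof -
    have "(b' has_derivative blinfun_apply (a'' z)) (at z)"
      using has_derivative_transform_within_open[OF a(2), of z "S \<inter> T" b'] that assms(1,2) ab' by auto
    from has_derivative_unique[OF this b(2)] that show ?thesis by (auto simp: blinfun_apply_inject)
  qed
  define c' where "c' z = (if z \<in> S then a' z else b' z)" for z
  define c'' where "c'' z = (if z \<in> S then a'' z else b'' z)" for z
  have cS: "c' z = a' z" "c'' z = a'' z" if "z \<in> S" for z using that by (auto simp: c'_def c''_def)
  have cT: "c' z = b' z" "c'' z = b'' z" if "z \<in> T" for z
    using that ab' ab'' by (auto simp: c'_def c''_def)
  have "(u has_derivative blinfun_apply (c' z)) (at z)" if "z \<in> S \<union> T" for z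
    using that a(1) b(1) cS cT by auto
  moreover have "(c' has_derivative blinfun_apply (c'' z)) (at z)" if "z \<in> S \<union> T" for z
    using that
  proof
    assume "z \<in> S"
    then show ?thesis
      using has_derivative_transform_within_open[OF a(2) assms(1), of z c'] cS by simp
  next
    assume "z \<in> T"
    then show ?thesis
      using has_derivative_transform_within_open[OF b(2) assms(2), of z c'] cT by simp
  qed
  moreover have "continuous_on (S \<union> T) c''"
    using a(3) b(3) cS cT assms(1,2)
    by (intro continuous_on_open_Un) (auto cong: continuous_on_cong)
  ultimately show ?thesis unfolding C2_on_def by blast
qed

text \<open>Were \<open>l\<close> positive, \<open>f'\<close> would be positive just to the right of its zero at the maximum, and \<open>f\<close> would
  increase there.\<close>
lemma second_derivative_nonpos_at_max:
  fixes f f' :: "real \<Rightarrow> real"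
  assumes "0 < d" and f: "\<And>t. \<bar>t\<bar> < d \<Longrightarrow> (f has_real_derivative f' t) (at t)"
    and l: "(f' has_real_derivative l) (at 0)"
    and max: "\<And>t. \<bar>t\<bar> < d \<Longrightarrow> f t \<le> f 0"
  shows "l \<le> 0"
proof (rule ccontr)
  assume "\<not> l \<le> 0"
  have "f' 0 = 0"
    by (rule DERIV_local_max[OF f \<open>0 < d\<close>]) (use assms in auto)
  then obtain e where e: "0 < e" "\<And>h. 0 < h \<Longrightarrow> h < e \<Longrightarrow> 0 < f' h"
    using DERIV_pos_inc_right[OF l] \<open>\<not> l \<le> 0\<close> by auto
  define h where "h = min d e / 2"
  have h: "0 < h" "h < d" "h < e" using e(1) \<open>0 < d\<close> by (auto simp: h_def min_def)
  have "\<exists>z>0. z < h \<and> f h - f 0 = (h - 0) * f' z"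
    by (rule MVT2) (use h f in auto)
  then obtain x where x: "0 < x" "x < h" "f h - f 0 = (h - 0) * f' x" by blast
  then have "f h > f 0" using e(2)[of x] h by simp (smt (verit) mult_pos_pos)
  with max[of h] h show False by auto
qed

text \<open>The infinitesimal form of the maximum principle: the second derivative test on every coordinate line
  through the maximum.\<close>
lemma laplacian_le_at_max_of_difference:
  fixes u w :: "'a::euclidean_space \<Rightarrow> real"
  assumes S: "open S" "z \<in> S" and "C2_on u S" "C2_on w S"
    and max: "\<And>y. y \<in> S \<Longrightarrow> u y - w y \<le> u z - w z"
  shows "laplacian u z \<le> laplacian w z"
proof -
  obtain a' a'' where a: "\<And>z. z \<in> S \<Longrightarrow> (u has_derivative blinfun_apply (a' z)) (at z)"
      "\<And>z. z \<in> S \<Longrightarrow> (a' has_derivative blinfun_apply (a'' z)) (at z)"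
    using assms(3) unfolding C2_on_def by blast
  obtain b' b'' where b: "\<And>z. z \<in> S \<Longrightarrow> (w has_derivative blinfun_apply (b' z)) (at z)"
      "\<And>z. z \<in> S \<Longrightarrow> (b' has_derivative blinfun_apply (b'' z)) (at z)"
    using assms(4) unfolding C2_on_def by blast
  have "a'' z e e - b'' z e e \<le> 0" for e
  proof -
    obtain d where d: "0 < d" "\<And>t. \<bar>t\<bar> < d \<Longrightarrow> z + t *\<^sub>R e \<in> S"
      using eventually_along_line_in_open[OF S, of e]
      by (auto simp: eventually_nhds_metric dist_real_def)
    have *: "((\<lambda>y. a' y e - b' y e) has_derivative (\<lambda>h. a'' z h e - b'' z h e)) (at (z + 0 *\<^sub>R e))"
      using a(2)[OF S(2)] b(2)[OF S(2)]
      by (auto intro!: derivative_intros bounded_linear.has_derivative[OF blinfun.bounded_linear_left])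
    show ?thesis
    proof (rule second_derivative_nonpos_at_max[OF d(1)])
      show "((\<lambda>t. u (z + t *\<^sub>R e) - w (z + t *\<^sub>R e)) has_real_derivative
              (a' (z + t *\<^sub>R e) e - b' (z + t *\<^sub>R e) e)) (at t)" if "\<bar>t\<bar> < d" for t
        by (intro DERIV_diff has_real_derivative_along_line a(1) b(1) d(2) that)
      show "((\<lambda>t. a' (z + t *\<^sub>R e) e - b' (z + t *\<^sub>R e) e) has_real_derivative
              (a'' z e e - b'' z e e)) (at 0)"
        using has_real_derivative_along_line[OF *] .
      show "u (z + t *\<^sub>R e) - w (z + t *\<^sub>R e) \<le> u (z + 0 *\<^sub>R e) - w (z + 0 *\<^sub>R e)"
        if "\<bar>t\<bar> < d" for t using max[OF d(2)[OF that]] by simp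
    qed
  qed
  then have "(\<Sum>e\<in>Basis. a'' z e e) \<le> (\<Sum>e\<in>Basis. b'' z e e)"
    by (intro sum_mono) simp
  then show ?thesis
    using laplacian_eq_trace[OF S a(1) a(2)[OF S(2)]] laplacian_eq_trace[OF S b(1) b(2)[OF S(2)]] by simp
qed

text \<open>Radial functions are written in terms of \<open>\<bar>z\<bar>\<^sup>2\<close> rather than \<open>\<bar>z\<bar>\<close>, because \<open>\<bar>z\<bar>\<^sup>2\<close> is smooth at the
  origin; one lemma then covers the discs around 0 as well as the punctured disc.\<close>
lemma
  fixes \<phi> \<phi>' \<phi>'' :: "real \<Rightarrow> real" and S :: "'a::euclidean_space set"
  assumes S: "open S" and I: "\<And>z. z \<in> S \<Longrightarrow> z \<bullet> z \<in> I"
    and 1: "\<And>q. q \<in> I \<Longrightarrow> (\<phi> has_real_derivative \<phi>' q) (at q)"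
    and 2: "\<And>q. q \<in> I \<Longrightarrow> (\<phi>' has_real_derivative \<phi>'' q) (at q)"
    and 3: "continuous_on I \<phi>''"
  shows C2_on_radial: "C2_on (\<lambda>z. \<phi> (z \<bullet> z)) S"
    and laplacian_radial: "z \<in> S \<Longrightarrow> laplacian (\<lambda>z. \<phi> (z \<bullet> z)) z =
           2 * DIM('a) * \<phi>' (z \<bullet> z) + 4 * (z \<bullet> z) * \<phi>'' (z \<bullet> z)"
proof -
  define u' where "u' z = (2 * \<phi>' (z \<bullet> z)) *\<^sub>R blinfun_inner_left z" for z :: 'a
  define D where "D z h = (4 * \<phi>'' (z \<bullet> z) * (z \<bullet> h)) *\<^sub>R blinfun_inner_left z
      + (2 * \<phi>' (z \<bullet> z)) *\<^sub>R blinfun_inner_left h" for z h :: 'a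
  have D: "bounded_linear (D z)" for z
    unfolding D_def
    by (intro bounded_linear_add bounded_linear_const_scaleR bounded_linear_blinfun_inner_left
        bounded_linear_scaleR_const bounded_linear_const_mult bounded_linear_inner_right)
  have u: "((\<lambda>z. \<phi> (z \<bullet> z)) has_derivative blinfun_apply (u' z)) (at z)" if "z \<in> S" for z
  proof -
    have "((\<lambda>z. \<phi> (z \<bullet> z)) has_derivative (\<lambda>h. \<phi>' (z \<bullet> z) * (z \<bullet> h + h \<bullet> z))) (at z)"
      by (rule has_derivative_compose[where f = "\<lambda>z. z \<bullet> z", OF _ 1[OF I[OF that], unfolded has_field_derivative_def]])
         (auto intro!: derivative_eq_intros)
    then show ?thesis
      by (rule has_derivative_eq_rhs) (auto simp: u'_def blinfun.bilinear_simps inner_commute)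
  qed
  have u': "(u' has_derivative blinfun_apply (Blinfun (D z))) (at z)" if "z \<in> S" for z
  proof -
    have "((\<lambda>z. \<phi>' (z \<bullet> z)) has_derivative (\<lambda>h. \<phi>'' (z \<bullet> z) * (z \<bullet> h + h \<bullet> z))) (at z)"
      by (rule has_derivative_compose[where f = "\<lambda>z. z \<bullet> z", OF _ 2[OF I[OF that], unfolded has_field_derivative_def]])
         (auto intro!: derivative_eq_intros)
    then have "(u' has_derivative (\<lambda>h. (2 * \<phi>' (z \<bullet> z)) *\<^sub>R blinfun_inner_left h
       + (2 * (\<phi>'' (z \<bullet> z) * (z \<bullet> h + h \<bullet> z))) *\<^sub>R blinfun_inner_left z)) (at z)"
      unfolding u'_def
      by (intro has_derivative_scaleR has_derivative_mult_right
          bounded_linear.has_derivative[OF bounded_linear_blinfun_inner_left] has_derivative_ident)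
    then show ?thesis
      unfolding bounded_linear_Blinfun_apply[OF D]
      by (rule has_derivative_eq_rhs) (auto simp: D_def inner_commute algebra_simps)
  qed
  have q: "continuous_on S (\<lambda>z. z \<bullet> z)" by (intro continuous_intros)
  have c2: "continuous_on S (\<lambda>z. \<phi>'' (z \<bullet> z))"
    by (rule continuous_on_compose2[OF 3 q]) (use I in auto)
  have "continuous_on I \<phi>'" using 2 by (meson DERIV_continuous continuous_at_imp_continuous_on)
  then have c1: "continuous_on S (\<lambda>z. \<phi>' (z \<bullet> z))"
    by (rule continuous_on_compose2[OF _ q]) (use I in auto)
  have "continuous_on S (\<lambda>z. Blinfun (D z))"
  proof (rule continuous_on_blinfun_componentwise)
    fix b :: 'a
    show "continuous_on S (\<lambda>z. Blinfun (D z) b)"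
      unfolding bounded_linear_Blinfun_apply[OF D] D_def
      by (intro continuous_intros c1 c2 bounded_linear.continuous_on[OF bounded_linear_blinfun_inner_left])
  qed
  with u u' show "C2_on (\<lambda>z. \<phi> (z \<bullet> z)) S"
    unfolding C2_on_def by (intro exI[of _ u'] exI[of _ "\<lambda>z. Blinfun (D z)"]) simp
  assume z: "z \<in> S"
  have "laplacian (\<lambda>z. \<phi> (z \<bullet> z)) z = (\<Sum>b\<in>Basis. Blinfun (D z) b b)"
    by (rule laplacian_eq_trace[OF S z u u'[OF z]])
  also have "\<dots> = (\<Sum>b\<in>Basis. 4 * \<phi>'' (z \<bullet> z) * ((z \<bullet> b) * (z \<bullet> b)) + 2 * \<phi>' (z \<bullet> z))"
    unfolding bounded_linear_Blinfun_apply[OF D]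
    by (intro sum.cong refl) (simp add: D_def blinfun.bilinear_simps algebra_simps inner_commute)
  also have "\<dots> = 4 * \<phi>'' (z \<bullet> z) * (z \<bullet> z) + 2 * DIM('a) * \<phi>' (z \<bullet> z)"
    unfolding sum.distrib sum_distrib_left[symmetric] euclidean_inner[of z z, symmetric] by simp
  finally show "laplacian (\<lambda>z. \<phi> (z \<bullet> z)) z =
           2 * DIM('a) * \<phi>' (z \<bullet> z) + 4 * (z \<bullet> z) * \<phi>'' (z \<bullet> z)" by simp
qed

section \<open>Two families of rotationally symmetric metrics\<close>

text \<open>The logarithm of the density \<open>2 * R / (sqrt k * (R\<^sup>2 - \<bar>z\<bar>\<^sup>2))\<close> of the complete metric of constant curvature
  \<open>- k\<close> on the disc of radius \<open>R\<close>.\<close>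
definition disc_log_density :: "real \<Rightarrow> real \<Rightarrow> complex \<Rightarrow> real" where
  "disc_log_density R k z = ln (2 * R / sqrt k) - ln (R\<^sup>2 - z \<bullet> z)"

lemma
  assumes "0 < R" "0 < k"
  shows C2_on_disc_log_density: "C2_on (disc_log_density R k) (ball 0 R)"
    and laplacian_disc_log_density: "z \<in> ball 0 R \<Longrightarrow> laplacian (disc_log_density R k) z = k * exp (2 * disc_log_density R k z)"
proof -
  have I: "z \<bullet> z \<in> {..<R\<^sup>2}" if "z \<in> ball 0 R" for z :: complex
    using that assms(1) by (simp add: dot_square_norm power_strict_mono)
  have 1: "((\<lambda>q. ln (2 * R / sqrt k) - ln (R\<^sup>2 - q)) has_real_derivative 1 / (R\<^sup>2 - q)) (at q)"
    if "q \<in> {..<R\<^sup>2}" for q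
    using that by (auto intro!: derivative_eq_intros)
  have 2: "((\<lambda>q. 1 / (R\<^sup>2 - q)) has_real_derivative 1 / (R\<^sup>2 - q)\<^sup>2) (at q)"
    if "q \<in> {..<R\<^sup>2}" for q
    using that by (auto intro!: derivative_eq_intros simp: power2_eq_square)
  have 3: "continuous_on {..<R\<^sup>2} (\<lambda>q. 1 / (R\<^sup>2 - q)\<^sup>2)"
    by (intro continuous_intros) auto
  have eq: "disc_log_density R k = (\<lambda>z. ln (2 * R / sqrt k) - ln (R\<^sup>2 - z \<bullet> z))"
    by (simp add: fun_eq_iff disc_log_density_def)
  show "C2_on (disc_log_density R k) (ball 0 R)"
    unfolding eq by (rule C2_on_radial[OF open_ball I 1 2 3])
  assume z: "z \<in> ball 0 R"
  have pos: "0 < R\<^sup>2 - z \<bullet> z" using I[OF z] by simp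
  have "exp (2 * disc_log_density R k z) = (exp (disc_log_density R k z))\<^sup>2"
    by (simp add: exp_double)
  also have "exp (disc_log_density R k z) = 2 * R / sqrt k / (R\<^sup>2 - z \<bullet> z)"
    using assms pos by (simp add: disc_log_density_def exp_diff)
  finally have "k * exp (2 * disc_log_density R k z) = 4 * R\<^sup>2 / (R\<^sup>2 - z \<bullet> z)\<^sup>2"
    using assms by (simp add: power_divide power_mult_distrib)
  moreover have "laplacian (disc_log_density R k) z = 4 * (1 / (R\<^sup>2 - z \<bullet> z)) + 4 * (z \<bullet> z) * (1 / (R\<^sup>2 - z \<bullet> z)\<^sup>2)"
    using laplacian_radial[OF open_ball I 1 2 3 z] unfolding eq by simp
  moreover have "\<dots> = 4 * R\<^sup>2 / (R\<^sup>2 - z \<bullet> z)\<^sup>2"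
  proof -
    have "4 * (1 / x) + 4 * q * (1 / x\<^sup>2) = 4 * (x + q) / x\<^sup>2" if "x \<noteq> 0" for x q :: real
      using that by (simp add: field_simps power2_eq_square)
    from this[of "R\<^sup>2 - z \<bullet> z" "z \<bullet> z"] show ?thesis using pos by simp
  qed
  ultimately show "laplacian (disc_log_density R k) z = k * exp (2 * disc_log_density R k z)" by simp
qed

text \<open>The logarithm of the density of \<open>\<bar>dz\<bar> / (\<bar>z\<bar> * g s)\<close>, \<open>s = - ln \<bar>z\<bar>\<close>. As \<open>\<bar>dz\<bar> / \<bar>z\<bar>\<close> is the flat metric of a
  cylinder on which \<open>s\<close> is the height, \<open>1 / g\<close> is a conformal factor on the cylinder.\<close>
definition cylindrical_log_density :: "(real \<Rightarrow> real) \<Rightarrow> complex \<Rightarrow> real" where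
  "cylindrical_log_density g z = - ln (norm z) - ln (g (- ln (norm z)))"

text \<open>On the cylinder the Laplacian of \<open>- ln g\<close> is just the second derivative \<open>(g'\<^sup>2 - g * g'') / g\<^sup>2\<close>, and the
  curvature \<open>- (g'\<^sup>2 - g * g'')\<close> results.\<close>
lemma
  assumes g: "\<And>s. 0 < s \<Longrightarrow> (g has_real_derivative g' s) (at s)"
    and g': "\<And>s. 0 < s \<Longrightarrow> (g' has_real_derivative g'' s) (at s)"
    and g'': "continuous_on {0<..} g''"
    and pos: "\<And>s. 0 < s \<Longrightarrow> 0 < g s"
  shows C2_on_cylindrical_log_density: "C2_on (cylindrical_log_density g) (ball 0 1 - {0})"
    and laplacian_cylindrical_log_density: "z \<in> ball 0 1 - {0} \<Longrightarrow> s = - ln (norm z) \<Longrightarrow>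
           laplacian (cylindrical_log_density g) z = ((g' s)\<^sup>2 - g s * g'' s) * exp (2 * cylindrical_log_density g z)"
proof -
  define S where "S = ball (0 :: complex) 1 - {0}"
  have S: "open S" unfolding S_def by (simp add: open_Diff)
  \<comment> \<open>the height \<open>s\<close> as a function of \<open>q = \<bar>z\<bar>\<^sup>2\<close>\<close>
  define \<sigma> where "\<sigma> q = - ln q / 2" for q :: real
  have \<sigma>_pos: "0 < \<sigma> q" if "q \<in> {0<..<1}" for q using that by (simp add: \<sigma>_def)
  have \<sigma>: "(\<sigma> has_real_derivative - 1 / (2 * q)) (at q)" if "q \<in> {0<..<1}" for q
    unfolding \<sigma>_def using that by (auto intro!: derivative_eq_intros)
  have \<sigma>_norm: "\<sigma> (z \<bullet> z) = - ln (norm z)" for z :: complex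
    by (cases "z = 0") (simp_all add: \<sigma>_def dot_square_norm ln_realpow)
  define \<phi> where "\<phi> q = \<sigma> q - ln (g (\<sigma> q))" for q
  define \<phi>' where "\<phi>' q = - (1 - g' (\<sigma> q) / g (\<sigma> q)) / (2 * q)" for q
  define \<phi>'' where "\<phi>'' q = (1 - g' (\<sigma> q) / g (\<sigma> q)) / (2 * q\<^sup>2)
    + ((g' (\<sigma> q))\<^sup>2 - g (\<sigma> q) * g'' (\<sigma> q)) / (4 * q\<^sup>2 * (g (\<sigma> q))\<^sup>2)" for q
  have I: "z \<bullet> z \<in> {0<..<1}" if "z \<in> S" for z
    using that by (auto simp: S_def dot_square_norm power_less_one_iff)
  have dg: "((\<lambda>q. g (\<sigma> q)) has_real_derivative g' (\<sigma> q) * (- 1 / (2 * q))) (at q)"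
    if "q \<in> {0<..<1}" for q
    by (rule DERIV_chain2[OF g[OF \<sigma>_pos] \<sigma>]) (use that in auto)
  have dg': "((\<lambda>q. g' (\<sigma> q)) has_real_derivative g'' (\<sigma> q) * (- 1 / (2 * q))) (at q)"
    if "q \<in> {0<..<1}" for q
    by (rule DERIV_chain2[OF g'[OF \<sigma>_pos] \<sigma>]) (use that in auto)
  have 1: "(\<phi> has_real_derivative \<phi>' q) (at q)" if q: "q \<in> {0<..<1}" for q
  proof -
    note [derivative_intros] = \<sigma>[OF q] dg[OF q]
    have "(\<phi> has_real_derivative - 1 / (2 * q) - (g' (\<sigma> q) * (- 1 / (2 * q))) / g (\<sigma> q)) (at q)"
      unfolding \<phi>_def using pos[OF \<sigma>_pos[OF q]]
      by (auto intro!: derivative_eq_intros)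
    moreover have "- 1 / (2 * q) - (g' (\<sigma> q) * (- 1 / (2 * q))) / g (\<sigma> q) = \<phi>' q"
      using q pos[OF \<sigma>_pos[OF q]] by (simp add: \<phi>'_def field_simps)
    ultimately show ?thesis by simp
  qed
  have 2: "(\<phi>' has_real_derivative \<phi>'' q) (at q)" if q: "q \<in> {0<..<1}" for q
  proof -
    have nz: "g (\<sigma> q) \<noteq> 0" "q \<noteq> 0" using q pos[OF \<sigma>_pos[OF q]] by auto
    have "(\<phi>' has_real_derivative
       ((- (0 - (g'' (\<sigma> q) * (- 1 / (2 * q)) * g (\<sigma> q) - g' (\<sigma> q) * (g' (\<sigma> q) * (- 1 / (2 * q)))) / (g (\<sigma> q) * g (\<sigma> q)))) * (2 * q)
         - (- (1 - g' (\<sigma> q) / g (\<sigma> q))) * 2) / (2 * q * (2 * q))) (at q)"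
      unfolding \<phi>'_def
      by (intro DERIV_divide DERIV_minus DERIV_diff DERIV_const dg[OF q] dg'[OF q] nz)
         (use nz in \<open>auto intro!: derivative_eq_intros\<close>)
    then show ?thesis
      by (rule DERIV_cong) (use nz in \<open>simp add: \<phi>''_def field_simps power2_eq_square\<close>)
  qed
  have c\<sigma>: "continuous_on {0<..<1} \<sigma>" using \<sigma> by (meson DERIV_continuous continuous_at_imp_continuous_on)
  have cg: "continuous_on {0<..<1} (\<lambda>q. g (\<sigma> q))" "continuous_on {0<..<1} (\<lambda>q. g' (\<sigma> q))"
    using dg dg' by (meson DERIV_continuous continuous_at_imp_continuous_on)+
  have cg'': "continuous_on {0<..<1} (\<lambda>q. g'' (\<sigma> q))"
    by (rule continuous_on_compose2[OF g'' c\<sigma>]) (use \<sigma>_pos in auto)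
  have nz: "g (\<sigma> q) \<noteq> 0" if "q \<in> {0<..<1}" for q using pos[OF \<sigma>_pos[OF that]] by auto
  have 3: "continuous_on {0<..<1} \<phi>''"
    unfolding \<phi>''_def by (intro continuous_intros cg cg'') (use nz in auto)
  have eq: "cylindrical_log_density g = (\<lambda>z. \<phi> (z \<bullet> z))"
    by (simp add: fun_eq_iff cylindrical_log_density_def \<phi>_def \<sigma>_norm)
  show "C2_on (cylindrical_log_density g) (ball 0 1 - {0})"
    unfolding eq S_def[symmetric] by (rule C2_on_radial[OF S I 1 2 3])
  assume "z \<in> ball 0 1 - {0}" and s: "s = - ln (norm z)"
  then have z: "z \<in> S" by (simp add: S_def)
  have nz: "norm z > 0" "g s > 0" using z s pos[of s] by (auto simp: S_def)
  have "exp s = 1 / norm z" using nz by (simp add: s exp_minus field_simps)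
  then have "exp (cylindrical_log_density g z) = 1 / (norm z * g s)"
    using nz unfolding cylindrical_log_density_def s[symmetric] by (simp add: exp_diff)
  then have "exp (2 * cylindrical_log_density g z) = 1 / ((z \<bullet> z) * (g s)\<^sup>2)"
    by (simp add: exp_double power_divide power_mult_distrib dot_square_norm)
  moreover have "laplacian (cylindrical_log_density g) z = 4 * \<phi>' (z \<bullet> z) + 4 * (z \<bullet> z) * \<phi>'' (z \<bullet> z)"
    using laplacian_radial[OF S I 1 2 3 z] unfolding eq by simp
  moreover have "\<dots> = ((g' s)\<^sup>2 - g s * g'' s) / ((z \<bullet> z) * (g s)\<^sup>2)"
    unfolding \<phi>'_def \<phi>''_def \<sigma>_norm s[symmetric] using I[OF z] nz
    by (simp add: field_simps power2_eq_square)
  ultimately show "laplacian (cylindrical_log_density g) z = ((g' s)\<^sup>2 - g s * g'' s) * exp (2 * cylindrical_log_density g z)"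
    by simp
qed

section \<open>Comparison with the disc of constant curvature\<close>

lemma gauss_curvature_exp:
  assumes "open S" "z \<in> S" "\<And>y. y \<in> S \<Longrightarrow> \<rho> y = exp (u y)"
  shows "gauss_curvature \<rho> z = - laplacian u z / exp (2 * u z)"
proof -
  have "laplacian (\<lambda>w. ln (\<rho> w)) z = laplacian u z"
    by (rule laplacian_cong[OF assms(1,2)]) (simp add: assms(3))
  then show ?thesis using assms(2,3) by (simp add: gauss_curvature_def exp_double)
qed

text \<open>At an interior maximum of \<open>u - w\<close>, with \<open>w\<close> the disc metric, \<open>\<Delta> u \<le> \<Delta> w = k * exp (2 * w)\<close>; if \<open>u\<close> exceeded \<open>w\<close>
  there, this would be less than \<open>k * exp (2 * u)\<close>.\<close>
lemma le_disc_log_density_if_le_on_circle: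
  assumes k: "0 < k" and r: "0 < r" "r < R" and S: "cball 0 r \<subseteq> S" and u: "C2_on u S"
    and lap: "\<And>z. z \<in> ball 0 r \<Longrightarrow> k * exp (2 * u z) \<le> laplacian u z"
    and bdry: "\<And>z. norm z = r \<Longrightarrow> u z \<le> disc_log_density R k z"
    and z: "norm z \<le> r"
  shows "u z \<le> disc_log_density R k z"
proof -
  let ?w = "disc_log_density R k"
  have R: "0 < R" using r by simp
  have uC: "C2_on u (cball 0 r)" using C2_on_subset[OF u S] .
  have wC: "C2_on ?w (cball 0 r)"
    by (rule C2_on_subset[OF C2_on_disc_log_density[OF R k]]) (use r in auto)
  obtain p where p: "p \<in> cball 0 r" "\<And>y. y \<in> cball 0 r \<Longrightarrow> u y - ?w y \<le> u p - ?w p"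
    using continuous_attains_sup[of "cball 0 r" "\<lambda>y. u y - ?w y"] r(1)
      continuous_on_diff[OF uC[THEN C2_on_imp_continuous_on] wC[THEN C2_on_imp_continuous_on]]
    by auto
  have "u p \<le> ?w p"
  proof (rule ccontr)
    assume gt: "\<not> u p \<le> ?w p"
    then have "norm p \<noteq> r" using bdry by blast
    then have pb: "p \<in> ball 0 r" using p(1) by auto
    have "laplacian u p \<le> laplacian ?w p"
      by (rule laplacian_le_at_max_of_difference[OF open_ball pb])
         (use p uC wC in \<open>auto intro: C2_on_subset\<close>)
    also have "\<dots> = k * exp (2 * ?w p)"
      by (rule laplacian_disc_log_density[OF R k]) (use pb r in auto)
    also have "\<dots> < k * exp (2 * u p)" using gt k by simp
    also have "\<dots> \<le> laplacian u p" by (rule lap[OF pb])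
    finally show False by simp
  qed
  with p(2)[of z] z show ?thesis by simp
qed

text \<open>The comparison metric agrees with the completion on \<open>\<bar>z\<bar> = r\<close> and lies above it inside, so its radial
  derivative at \<open>r\<close> is the smaller one. With \<open>a = - ln r\<close> and \<open>m\<^sup>2 = a\<^sup>2 + k\<close> the logarithmic derivatives are
  \<open>(1 / a - 1) / r\<close> for the cusp metric and \<open>(m / a - 1) / r\<close> for the disc.\<close>
lemma completion_radius_bound:
  assumes k: "0 < k" and r: "0 < r" "r < 1" and \<rho>: "conformal_completion r \<rho>"
    and curv: "\<And>z. z \<in> ball 0 1 \<Longrightarrow> gauss_curvature \<rho> z \<le> - k"
  shows "(ln r)\<^sup>2 \<le> 1 - k"
proof -
  obtain u where u: "C2_on u (ball 0 1)" and \<rho>u: "\<And>z. z \<in> ball 0 1 \<Longrightarrow> \<rho> z = exp (u z)"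
    using \<rho> unfolding conformal_completion_def by blast
  have hyp: "u z = - ln (norm z) - ln (- ln (norm z))" if "r \<le> norm z" "norm z < 1" for z
  proof -
    have "exp (u z) = hyp_density z"
      using \<rho> \<rho>u[of z] that unfolding conformal_completion_def by auto
    also have "\<dots> = exp (- ln (norm z) - ln (- ln (norm z)))"
    proof -
      have "0 < norm z" "ln (norm z) < 0" using that r ln_less_zero[of "norm z"] by linarith+
      then show ?thesis by (simp add: hyp_density_def exp_diff exp_minus field_simps)
    qed
    finally show ?thesis by simp
  qed
  define a where "a = - ln r"
  \<comment> \<open>\<open>R\<close> solves \<open>2 * R / (sqrt k * (R\<^sup>2 - r\<^sup>2)) = 1 / (r * a)\<close>, a quadratic equation: the disc metric then has the
      density of the cusp metric on \<open>\<bar>z\<bar> = r\<close>\<close>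
  define m where "m = sqrt (a\<^sup>2 + k)"
  define R where "R = r * (a + m) / sqrt k"
  have a: "0 < a" using r by (simp add: a_def)
  have m: "0 < m" "m\<^sup>2 = a\<^sup>2 + k" "sqrt k < m"
    using k a by (auto simp: m_def add_nonneg_pos)
  have "r * sqrt k < r * (a + m)" using r a m by (intro mult_strict_left_mono) auto
  then have R: "r < R" "0 < R"
    using k r a m by (auto simp: R_def less_divide_eq)
  have R2: "R\<^sup>2 - r\<^sup>2 = 2 * r\<^sup>2 * a * (a + m) / k"
  proof -
    have "R\<^sup>2 = r\<^sup>2 * (a + m)\<^sup>2 / k"
      using k by (simp add: R_def power_divide power_mult_distrib)
    then have "R\<^sup>2 - r\<^sup>2 = r\<^sup>2 * ((a + m)\<^sup>2 - k) / k"
      using k by (simp add: right_diff_distrib diff_divide_distrib)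
    then have "R\<^sup>2 - r\<^sup>2 = r\<^sup>2 * ((a + m)\<^sup>2 - (m\<^sup>2 - a\<^sup>2)) / k"
      using m(2) by simp
    then show ?thesis by (simp add: power2_eq_square algebra_simps)
  qed
  have w_bdry: "disc_log_density R k z = - ln r - ln a" if "norm z = r" for z
  proof -
    have "2 * R / sqrt k / (R\<^sup>2 - r\<^sup>2) = 1 / (r * a)"
    proof -
      have "2 * r * p / k / (2 * r\<^sup>2 * a * p / k) = 1 / (r * a)" if "0 < p" for p
        using that k r a by (simp add: divide_simps power2_eq_square)
      moreover have "2 * R / sqrt k = 2 * r * (a + m) / k"
        using k by (simp add: R_def)
      ultimately show ?thesis unfolding R2 using a m by simp
    qed
    moreover have "0 < R\<^sup>2 - r\<^sup>2" unfolding R2 using k r a m by simp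
    moreover have "0 < 2 * R / sqrt k" using k R by simp
    ultimately have "ln (1 / (r * a)) = ln (2 * R / sqrt k) - ln (R\<^sup>2 - r\<^sup>2)"
      using ln_div[of "2 * R / sqrt k" "R\<^sup>2 - r\<^sup>2"] k R by simp
    then have "disc_log_density R k z = ln (1 / (r * a))"
      using that by (simp add: disc_log_density_def dot_square_norm)
    then show ?thesis using r a by (simp add: ln_div ln_mult)
  qed
  have u_bdry: "u z = - ln r - ln a" if "norm z = r" for z
    using hyp[of z] that r by (simp add: a_def)
  have le: "u z \<le> disc_log_density R k z" if "norm z \<le> r" for z
  proof (rule le_disc_log_density_if_le_on_circle[OF k r(1) R(1) _ u _ _ that])
    show "cball 0 r \<subseteq> ball (0 :: complex) 1" using r by auto
    show "k * exp (2 * u z) \<le> laplacian u z" if "z \<in> ball 0 r" for z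
    proof -
      have z: "z \<in> ball 0 1" using that r by auto
      have "- laplacian u z / exp (2 * u z) \<le> - k"
        using curv[OF z] gauss_curvature_exp[OF open_ball z, of \<rho> u] \<rho>u by simp
      then show ?thesis by (simp add: field_simps)
    qed
    show "u z \<le> disc_log_density R k z" if "norm z = r" for z
      using that by (simp add: u_bdry w_bdry)
  qed
  \<comment> \<open>logarithmic densities of the completion, the disc metric and the cusp metric on the positive real axis\<close>
  define U where "U x = u (0 + x *\<^sub>R 1)" for x :: real
  define W where "W x = ln (2 * R / sqrt k) - ln (R\<^sup>2 - x\<^sup>2)" for x :: real
  define H where "H x = - ln x - ln (- ln x)" for x :: real
  have "0 + r *\<^sub>R 1 \<in> ball (0 :: complex) 1" using r by simp
  then obtain d where dU: "(U has_real_derivative d) (at r)"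
    using u has_real_derivative_along_line[of u _ 0 r 1] unfolding C2_on_def U_def by blast
  have dW: "(W has_real_derivative 2 * r / (R\<^sup>2 - r\<^sup>2)) (at r)"
    unfolding W_def using R2 k r a m by (auto intro!: derivative_eq_intros)
  have dH: "(H has_real_derivative - 1 / r + 1 / (r * a)) (at r)"
    unfolding H_def using r by (auto intro!: derivative_eq_intros simp: a_def field_simps)
  have UH: "U x = H x" if "r \<le> x" "x < 1" for x
    using hyp[of "of_real x"] that r by (simp add: U_def H_def of_real_def)
  have UW: "U x \<le> W x" if "0 \<le> x" "x \<le> r" for x
    using le[of "of_real x"] that
    by (simp add: U_def W_def disc_log_density_def dot_square_norm of_real_def)
  have UWr: "U r = W r"
    using u_bdry[of "of_real r"] w_bdry[of "of_real r"] r
    by (simp add: U_def W_def disc_log_density_def dot_square_norm of_real_def)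
  \<comment> \<open>to the right of \<open>r\<close> the completion is the cusp metric, so the derivative from the right bounds \<open>d\<close>\<close>
  have "d - (- 1 / r + 1 / (r * a)) \<le> 0"
  proof (rule ccontr)
    assume "\<not> ?thesis"
    then obtain e where e: "e > 0" "\<And>h. h > 0 \<Longrightarrow> h < e \<Longrightarrow> U r - H r < U (r + h) - H (r + h)"
      using DERIV_pos_inc_right[OF DERIV_diff[OF dU dH]] by auto
    define h where "h = min e (1 - r) / 2"
    have "0 < h" "h < e" "h < 1 - r" using e(1) r by (auto simp: h_def min_def)
    then show False using e(2)[of h] UH[of r] UH[of "r + h"] r by simp
  qed
  \<comment> \<open>to the left of \<open>r\<close> the completion lies below the disc metric\<close>
  moreover have "0 \<le> d - 2 * r / (R\<^sup>2 - r\<^sup>2)"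
  proof (rule ccontr)
    assume "\<not> ?thesis"
    then obtain e where e: "e > 0" "\<And>h. h > 0 \<Longrightarrow> h < e \<Longrightarrow> U r - W r < U (r - h) - W (r - h)"
      using DERIV_neg_dec_left[OF DERIV_diff[OF dU dW]] by auto
    define h where "h = min e r / 2"
    have "0 < h" "h < e" "h < r" using e(1) r by (auto simp: h_def min_def)
    then show False using e(2)[of h] UWr UW[of "r - h"] r by simp
  qed
  ultimately have "2 * r / (R\<^sup>2 - r\<^sup>2) \<le> - 1 / r + 1 / (r * a)" by linarith
  moreover have "2 * r / (R\<^sup>2 - r\<^sup>2) = (m / a - 1) / r"
  proof -
    have "k = (m - a) * (m + a)" using m(2) by (simp add: power2_eq_square algebra_simps)
    then have "2 * r / (R\<^sup>2 - r\<^sup>2) = 2 * r * ((m - a) * (m + a)) / (2 * r\<^sup>2 * a * (a + m))"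
      unfolding R2 by simp
    also have "\<dots> = (m / a - 1) / r"
      using r a m by (simp add: divide_simps power2_eq_square)
    finally show ?thesis .
  qed
  ultimately have "m \<le> 1" using r a by (simp add: field_simps)
  then have "m\<^sup>2 \<le> 1" using m(1) by (simp add: power_le_one)
  then show ?thesis using m(2) by (simp add: a_def)
qed

section \<open>Interpolation between the cusp and the disc\<close>

definition clamp01 :: "real \<Rightarrow> real" where "clamp01 t = max 0 (min 1 t)"

text \<open>The corners of the clamp do no harm where \<open>F'\<close> vanishes. Applied to a polynomial and then to its derivative,
  this yields a cutoff of class \<open>C\<^sup>2\<close>.\<close>
lemma has_real_derivative_comp_clamp01:
  fixes F F' :: "real \<Rightarrow> real"
  assumes F: "\<And>x. (F has_real_derivative F' x) (at x)" and "F' 0 = 0" "F' 1 = 0"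
  shows "((\<lambda>t. F (clamp01 t)) has_real_derivative F' (clamp01 t)) (at t)"
proof (cases "t \<in> {0<..<1}")
  case True
  have "((\<lambda>t. F (clamp01 t)) has_real_derivative F' t) (at t)"
    by (rule has_field_derivative_transform_within_open[OF F _ True]) (auto simp: clamp01_def)
  then show ?thesis using True by (simp add: clamp01_def)
next
  case False
  then have "clamp01 t = 0 \<or> clamp01 t = 1" by (auto simp: clamp01_def)
  then have 0: "F' (clamp01 t) = 0" using assms(2,3) by auto
  \<comment> \<open>in Caratheodory's form the difference quotient of the composition is \<open>G\<close> times a quotient bounded by 1\<close>
  obtain G where G: "\<And>y. F y - F (clamp01 t) = G y * (y - clamp01 t)"
      "isCont G (clamp01 t)" "G (clamp01 t) = 0"
    using F[of "clamp01 t"] unfolding CARAT_DERIV 0 by blast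
  have "isCont clamp01 t" unfolding clamp01_def by (intro continuous_intros)
  then have "isCont (\<lambda>y. G (clamp01 y)) t" using G(2) by (rule isCont_o2)
  then have lim: "((\<lambda>y. \<bar>G (clamp01 y)\<bar>) \<longlongrightarrow> 0) (at t)"
    using G(3) by (simp add: isCont_def tendsto_rabs_zero)
  have "norm ((F (clamp01 y) - F (clamp01 t)) / (y - t)) \<le> \<bar>G (clamp01 y)\<bar>" for y
  proof -
    have "\<bar>clamp01 y - clamp01 t\<bar> \<le> \<bar>y - t\<bar>" by (auto simp: clamp01_def)
    then have "\<bar>clamp01 y - clamp01 t\<bar> / \<bar>y - t\<bar> \<le> 1" by (simp add: divide_le_eq_1)
    from mult_left_mono[OF this, of "\<bar>G (clamp01 y)\<bar>"] show ?thesis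
      unfolding G(1) by (simp add: abs_mult)
  qed
  then show ?thesis
    unfolding 0 has_field_derivative_iff by (intro Lim_null_comparison[OF _ lim] always_eventually allI)
qed

text \<open>The polynomial of least degree that rises from 0 to 1 on the unit interval with first and second
  derivatives vanishing at both ends, followed by these derivatives.\<close>
definition smoothstep :: "real \<Rightarrow> real" where "smoothstep c = c ^ 3 * (6 * c\<^sup>2 - 15 * c + 10)"
definition smoothstep1 :: "real \<Rightarrow> real" where "smoothstep1 c = 30 * (c * (1 - c))\<^sup>2"
definition smoothstep2 :: "real \<Rightarrow> real" where "smoothstep2 c = 60 * (c * (1 - c)) * (1 - 2 * c)"

lemma smoothstep_derivs:
  "(smoothstep has_real_derivative smoothstep1 c) (at c)" "(smoothstep1 has_real_derivative smoothstep2 c) (at c)"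
proof -
  have 0: "smoothstep = (\<lambda>c. 6 * c ^ 5 - 15 * c ^ 4 + 10 * c ^ 3)"
    unfolding fun_eq_iff smoothstep_def by algebra
  have 1: "smoothstep1 = (\<lambda>c. 30 * c ^ 4 - 60 * c ^ 3 + 30 * c\<^sup>2)"
    unfolding fun_eq_iff smoothstep1_def by algebra
  have 2: "smoothstep2 c = 120 * c ^ 3 - 180 * c\<^sup>2 + 60 * c"
    unfolding smoothstep2_def by algebra
  show "(smoothstep has_real_derivative smoothstep1 c) (at c)"
    unfolding 0 1 by ((rule derivative_eq_intros refl)+) simp
  show "(smoothstep1 has_real_derivative smoothstep2 c) (at c)"
    unfolding 1 2 by ((rule derivative_eq_intros refl)+) simp
qed

lemma smoothstep_bounds:
  assumes "0 \<le> c" "c \<le> 1"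
  shows "0 \<le> smoothstep c" "smoothstep c \<le> 1" "\<bar>smoothstep1 c\<bar> \<le> 2" "\<bar>smoothstep2 c\<bar> \<le> 15"
proof -
  have "smoothstep 0 \<le> smoothstep c" "smoothstep c \<le> smoothstep 1"
    by (rule DERIV_nonneg_imp_nondecreasing; use assms smoothstep_derivs(1) in \<open>force simp: smoothstep1_def\<close>)+
  then show "0 \<le> smoothstep c" "smoothstep c \<le> 1" by (auto simp: smoothstep_def)
  have "0 \<le> (1 / 2 - c)\<^sup>2" by simp
  then have q: "0 \<le> c * (1 - c)" "c * (1 - c) \<le> 1 / 4"
    using assms by (auto simp: power2_eq_square algebra_simps mult_left_le)
  have "(c * (1 - c))\<^sup>2 \<le> (1 / 4)\<^sup>2" by (rule power_mono) (use q in auto)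
  then have "(c * (1 - c))\<^sup>2 \<le> 1 / 16" by (simp add: power_divide)
  then show "\<bar>smoothstep1 c\<bar> \<le> 2" by (simp add: smoothstep1_def)
  have "\<bar>c * (1 - c)\<bar> * \<bar>1 - 2 * c\<bar> \<le> 1 / 4 * 1"
    by (rule mult_mono) (use q assms in auto)
  then show "\<bar>smoothstep2 c\<bar> \<le> 15" by (simp add: smoothstep2_def abs_mult)
qed

text \<open>Crude Taylor estimates; the order in \<open>s\<close> is what matters.\<close>
lemma sinh_bounds:
  fixes s :: real
  assumes "0 \<le> s"
  shows "s \<le> sinh s" 
    and "s \<le> 1 \<Longrightarrow> sinh s \<le> 2 * s" 
    and "s \<le> 1 \<Longrightarrow> cosh s - 1 \<le> s\<^sup>2" 
    and "s \<le> 1 \<Longrightarrow> sinh s - s \<le> s ^ 3"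
proof -
  have "sinh 0 - 0 \<le> sinh s - s"
  proof (rule DERIV_nonneg_imp_nondecreasing[OF assms])
    fix y :: real
    have "((\<lambda>s. sinh s - s) has_real_derivative cosh y - 1) (at y)"
      by (auto intro!: derivative_eq_intros)
    then show "\<exists>d. ((\<lambda>s. sinh s - s) has_real_derivative d) (at y) \<and> 0 \<le> d"
      using cosh_real_ge_1[of y] by force
  qed
  then show "s \<le> sinh s" by simp
  have c: "cosh x \<le> 2" if "0 \<le> x" "x \<le> 1" for x :: real
  proof -
    have "exp x + exp (- x) \<le> 3 + 1"
      by (rule add_mono[OF order_trans[OF _ exp_le]]) (use that in auto)
    then show ?thesis by (simp add: cosh_field_def)
  qed
  have 1: "sinh x \<le> 2 * x" if "0 \<le> x" "x \<le> 1" for x :: real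
  proof -
    have "2 * 0 - sinh 0 \<le> 2 * x - sinh x"
    proof (rule DERIV_nonneg_imp_nondecreasing[OF that(1)])
      fix y :: real assume y: "0 \<le> y" "y \<le> x"
      have "((\<lambda>x. 2 * x - sinh x) has_real_derivative 2 - cosh y) (at y)"
        by (auto intro!: derivative_eq_intros)
      moreover have "0 \<le> 2 - cosh y" using c[of y] y that by simp
      ultimately show "\<exists>d. ((\<lambda>x. 2 * x - sinh x) has_real_derivative d) (at y) \<and> 0 \<le> d" by blast
    qed
    then show ?thesis by simp
  qed
  have 2: "cosh x - 1 \<le> x\<^sup>2" if "0 \<le> x" "x \<le> 1" for x :: real
  proof -
    have "0\<^sup>2 - cosh 0 \<le> x\<^sup>2 - cosh x"
    proof (rule DERIV_nonneg_imp_nondecreasing[OF that(1)])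
      fix y :: real assume y: "0 \<le> y" "y \<le> x"
      have "((\<lambda>x. x\<^sup>2 - cosh x) has_real_derivative 2 * y - sinh y) (at y)"
        by (auto intro!: derivative_eq_intros)
      moreover have "0 \<le> 2 * y - sinh y" using 1[of y] y that by simp
      ultimately show "\<exists>d. ((\<lambda>x. x\<^sup>2 - cosh x) has_real_derivative d) (at y) \<and> 0 \<le> d" by blast
    qed
    then show ?thesis by simp
  qed
  have 3: "sinh x - x \<le> x ^ 3" if "0 \<le> x" "x \<le> 1" for x :: real
  proof -
    have "0 ^ 3 + 0 - sinh 0 \<le> x ^ 3 + x - sinh x"
    proof (rule DERIV_nonneg_imp_nondecreasing[OF that(1)])
      fix y :: real assume y: "0 \<le> y" "y \<le> x"
      have "((\<lambda>x. x ^ 3 + x - sinh x) has_real_derivative 3 * y\<^sup>2 + 1 - cosh y) (at y)"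
        by (auto intro!: derivative_eq_intros)
      moreover have "0 \<le> 3 * y\<^sup>2 + 1 - cosh y" using 2[of y] y that zero_le_power2[of y] by linarith
      ultimately show "\<exists>d. ((\<lambda>x. x ^ 3 + x - sinh x) has_real_derivative d) (at y) \<and> 0 \<le> d" by blast
    qed
    then show ?thesis by simp
  qed
  show "s \<le> 1 \<Longrightarrow> sinh s \<le> 2 * s" "s \<le> 1 \<Longrightarrow> cosh s - 1 \<le> s\<^sup>2" "s \<le> 1 \<Longrightarrow> sinh s - s \<le> s ^ 3"
    using assms 1 2 3 by auto
qed

text \<open>The profile is \<open>g s = s + \<chi> s * (sinh s - s)\<close>, with a cutoff \<open>\<chi>\<close> that rises from 0 to 1 on the interval from
  \<open>a\<close> to \<open>2 * a\<close>. There \<open>sinh s - s\<close> has order \<open>a ^ 3\<close>, and each derivative, whether it falls on it or on \<open>\<chi>\<close>,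
  loses one factor \<open>a\<close>. So \<open>g = O(a)\<close>, \<open>g' - 1 = O(a\<^sup>2)\<close>, \<open>g'' = O(a)\<close>, and \<open>g'\<^sup>2 - g * g'' - 1 = O(a\<^sup>2)\<close>.\<close>
lemma interpolating_profile:
  fixes a :: real
  assumes a: "0 < a" "a \<le> 1 / 2"
  obtains g g' g'' :: "real \<Rightarrow> real" where
    "\<And>s. (g has_real_derivative g' s) (at s)" "\<And>s. (g' has_real_derivative g'' s) (at s)"
    "continuous_on {0<..} g''" "\<And>s. 0 < s \<Longrightarrow> 0 < g s"
    "\<And>s. s \<le> a \<Longrightarrow> g s = s" "\<And>s. 2 * a \<le> s \<Longrightarrow> g s = sinh s"
    "\<And>s. 0 < s \<Longrightarrow> \<bar>(g' s)\<^sup>2 - g s * g'' s - 1\<bar> \<le> 1000 * a\<^sup>2"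
proof -
  define c where "c s = clamp01 ((s - a) / a)" for s
  have c01: "0 \<le> c s" "c s \<le> 1" for s by (auto simp: c_def clamp01_def)
  have c0: "c s = 0" if "s \<le> a" for s using that a by (auto simp: c_def clamp01_def field_simps)
  have c1: "c s = 1" if "2 * a \<le> s" for s using that a by (auto simp: c_def clamp01_def field_simps)
  have lin: "((\<lambda>s. (s - a) / a) has_real_derivative 1 / a) (at s)" for s
    using a by (auto intro!: derivative_eq_intros)
  have dstep: "((\<lambda>s. smoothstep (c s)) has_real_derivative smoothstep1 (c s) * (1 / a)) (at s)" for s
    unfolding c_def
    by (rule DERIV_chain2[OF has_real_derivative_comp_clamp01[OF smoothstep_derivs(1)] lin]) (auto simp: smoothstep1_def)
  have dstep1: "((\<lambda>s. smoothstep1 (c s)) has_real_derivative smoothstep2 (c s) * (1 / a)) (at s)" for s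
    unfolding c_def
    by (rule DERIV_chain2[OF has_real_derivative_comp_clamp01[OF smoothstep_derivs(2)] lin]) (auto simp: smoothstep2_def)
  define g where "g s = s + smoothstep (c s) * (sinh s - s)" for s
  define g' where "g' s = 1 + (smoothstep1 (c s) / a * (sinh s - s) + smoothstep (c s) * (cosh s - 1))" for s
  define g'' where "g'' s = smoothstep2 (c s) / a\<^sup>2 * (sinh s - s)
      + 2 * (smoothstep1 (c s) / a * (cosh s - 1)) + smoothstep (c s) * sinh s" for s
  show thesis
  proof
    show "(g has_real_derivative g' s) (at s)" for s
      unfolding g_def g'_def by (auto intro!: derivative_eq_intros dstep)
    show "(g' has_real_derivative g'' s) (at s)" for s
      unfolding g'_def g''_def using a
      by (auto intro!: derivative_eq_intros dstep dstep1 simp: power2_eq_square field_simps)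
    have "continuous_on {0<..} c" unfolding c_def clamp01_def using a by (intro continuous_intros) auto
    then show "continuous_on {0<..} g''"
      unfolding g''_def smoothstep_def smoothstep1_def smoothstep2_def using a by (intro continuous_intros) auto
    show "0 < g s" if "0 < s" for s
      using that smoothstep_bounds(1)[OF c01] sinh_bounds(1)[of s]
      by (auto simp: g_def intro!: add_pos_nonneg mult_nonneg_nonneg)
    show "g s = s" if "s \<le> a" for s using c0[OF that] by (simp add: g_def smoothstep_def)
    show "g s = sinh s" if "2 * a \<le> s" for s using c1[OF that] by (simp add: g_def smoothstep_def)
    show "\<bar>(g' s)\<^sup>2 - g s * g'' s - 1\<bar> \<le> 1000 * a\<^sup>2" if s: "0 < s" for s
    proof -
      consider "s \<le> a" | "2 * a \<le> s" | "a \<le> s" "s \<le> 2 * a" by linarith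
      then show ?thesis
      proof cases
        case 1
        then show ?thesis
          by (simp add: g_def g'_def g''_def c0 smoothstep_def smoothstep1_def smoothstep2_def)
      next
        case 2
        have "(cosh s)\<^sup>2 - sinh s * sinh s = 1" using hyperbolic_pythagoras[of s] by (simp add: power2_eq_square)
        with 2 show ?thesis
          by (simp add: g_def g'_def g''_def c1 smoothstep_def smoothstep1_def smoothstep2_def)
      next
        case 3
        have s1: "0 \<le> s" "s \<le> 1" using 3 a by auto
        note sb = smoothstep_bounds[OF c01[of s]]
        have "s ^ 3 \<le> (2 * a) ^ 3" "s\<^sup>2 \<le> (2 * a)\<^sup>2"
          using s1 3 by (intro power_mono; simp)+
        then have d: "\<bar>sinh s - s\<bar> \<le> 8 * a ^ 3" "\<bar>cosh s - 1\<bar> \<le> 4 * a\<^sup>2" "\<bar>sinh s\<bar> \<le> 4 * a"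
          using sinh_bounds[OF s1(1)] s1 3 cosh_real_ge_1[of s] by (auto simp: power_mult_distrib)
        have st: "\<bar>smoothstep (c s)\<bar> \<le> 1" "\<bar>smoothstep1 (c s) / a\<bar> \<le> 2 / a" "\<bar>smoothstep2 (c s) / a\<^sup>2\<bar> \<le> 15 / a\<^sup>2"
          using sb a by (auto simp: abs_mult divide_right_mono)
        have prods: "\<bar>smoothstep1 (c s) / a * (sinh s - s)\<bar> \<le> 2 / a * (8 * a ^ 3)"
          "\<bar>smoothstep (c s) * (cosh s - 1)\<bar> \<le> 1 * (4 * a\<^sup>2)"
          "\<bar>smoothstep2 (c s) / a\<^sup>2 * (sinh s - s)\<bar> \<le> 15 / a\<^sup>2 * (8 * a ^ 3)"
          "\<bar>smoothstep1 (c s) / a * (cosh s - 1)\<bar> \<le> 2 / a * (4 * a\<^sup>2)"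
          "\<bar>smoothstep (c s) * sinh s\<bar> \<le> 1 * (4 * a)"
          unfolding abs_mult[of "_ / _"] abs_mult[of "smoothstep _"]
          by (intro mult_mono st d; use a in simp)+
        have pw: "2 / a * (8 * a ^ 3) = 16 * a\<^sup>2" "15 / a\<^sup>2 * (8 * a ^ 3) = 120 * a" "2 / a * (4 * a\<^sup>2) = 8 * a"
          using a by (auto simp: power2_eq_square power3_eq_cube)
        define x where "x = g' s - 1"
        have x: "\<bar>x\<bar> \<le> 20 * a\<^sup>2"
          using prods(1,2) unfolding x_def g'_def pw by linarith
        have g2: "\<bar>g'' s\<bar> \<le> 140 * a"
          using prods(3-5) unfolding g''_def pw by linarith
        define y where "y = smoothstep (c s) * (sinh s - s)"
        have "y \<le> 1 * (sinh s - s)"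
          unfolding y_def by (rule mult_right_mono[OF sb(2)]) (use sinh_bounds(1)[OF s1(1)] in simp)
        moreover have "0 \<le> y"
          unfolding y_def using sb(1) sinh_bounds(1)[OF s1(1)] by simp
        ultimately have "0 \<le> g s" "g s \<le> sinh s" using s1(1) by (simp_all add: g_def y_def)
        then have "\<bar>g s\<bar> \<le> 4 * a" using order_trans[OF _ abs_le_D1[OF d(3)]] by simp
        then have "\<bar>g s * g'' s\<bar> \<le> 4 * a * (140 * a)"
          unfolding abs_mult using g2 a by (intro mult_mono) auto
        then have 1: "\<bar>g s * g'' s\<bar> \<le> 560 * a\<^sup>2" by (simp add: power2_eq_square)
        have "a\<^sup>2 \<le> (1 / 2)\<^sup>2" using a by (intro power_mono) auto
        then have "\<bar>x\<bar> \<le> 5" using x by (simp add: power2_eq_square)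
        then have "\<bar>x\<bar> * \<bar>x\<bar> \<le> 5 * \<bar>x\<bar>" by (intro mult_right_mono) auto
        then have "\<bar>2 * x + x * x\<bar> \<le> 140 * a\<^sup>2" using x abs_triangle_ineq[of "2 * x" "x * x"] by (simp add: abs_mult)
        moreover have "(g' s)\<^sup>2 - 1 = 2 * x + x * x" by (simp add: x_def power2_eq_square algebra_simps)
        ultimately show ?thesis using 1 by linarith
      qed
    qed
  qed
qed

text \<open>The metric with the interpolating profile. For \<open>s \<ge> 2 * a\<close> the profile is \<open>sinh\<close>, and
  \<open>1 / (\<bar>z\<bar> * sinh s) = 2 / (1 - \<bar>z\<bar>\<^sup>2)\<close> is the hyperbolic metric of the unit disc, which extends over 0.\<close>
lemma exists_completion:
  assumes r: "0 < r" "r < 1" and a: "- ln r \<le> 1 / 2"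
  obtains \<rho> where "conformal_completion r \<rho>"
    "\<And>z. z \<in> ball 0 1 \<Longrightarrow> \<bar>gauss_curvature \<rho> z + 1\<bar> \<le> 1000 * (ln r)\<^sup>2"
proof -
  define a where "a = - ln r"
  have a: "0 < a" "a \<le> 1 / 2" using r a by (auto simp: a_def)
  obtain g g' g'' :: "real \<Rightarrow> real" where g:
    "\<And>s. (g has_real_derivative g' s) (at s)" "\<And>s. (g' has_real_derivative g'' s) (at s)"
    "continuous_on {0<..} g''" "\<And>s. 0 < s \<Longrightarrow> 0 < g s"
    "\<And>s. s \<le> a \<Longrightarrow> g s = s" "\<And>s. 2 * a \<le> s \<Longrightarrow> g s = sinh s"
    "\<And>s. 0 < s \<Longrightarrow> \<bar>(g' s)\<^sup>2 - g s * g'' s - 1\<bar> \<le> 1000 * a\<^sup>2"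
    using interpolating_profile[OF a] by blast
  define \<delta> where "\<delta> = exp (- 2 * a)"
  have \<delta>: "0 < \<delta>" "\<delta> < 1" using a by (auto simp: \<delta>_def)
  have \<delta>_iff: "norm z \<le> \<delta> \<longleftrightarrow> 2 * a \<le> - ln (norm z)" if "z \<noteq> 0" for z :: complex
    using that ln_le_cancel_iff[of "norm z" \<delta>] \<delta> by (auto simp: \<delta>_def)
  define D where "D = disc_log_density 1 1"
  define L where "L = cylindrical_log_density g"
  define u where "u z = (if norm z < \<delta> then D z else L z)" for z
  have DL: "D z = L z" if "z \<noteq> 0" "norm z < \<delta>" for z
  proof -
    define s where "s = - ln (norm z)"
    have "2 * a \<le> s" using that \<delta>_iff[of z] by (simp add: s_def)
    moreover from this have "0 < s" using a by linarith
    ultimately have s: "2 * a \<le> s" "0 < s" "exp (- s) = norm z" using that(1) a by (simp_all add: s_def)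
    have "1 - z \<bullet> z = 1 - (exp (- s))\<^sup>2" by (simp add: s dot_square_norm)
    also have "\<dots> = 2 * exp (- s) * sinh s"
      by (simp add: sinh_field_def power2_eq_square algebra_simps flip: exp_add)
    finally have "D z = ln 2 - ln (2 * exp (- s) * sinh s)"
      by (simp add: D_def disc_log_density_def)
    also have "\<dots> = s - ln (sinh s)" using s(2) by (simp add: ln_mult)
    also have "\<dots> = L z" using s g(6)[of s] by (simp add: L_def cylindrical_log_density_def s_def)
    finally show ?thesis .
  qed
  define A where "A = ball (0 :: complex) \<delta>"
  define B where "B = ball (0 :: complex) 1 - {0}"
  have AB: "open A" "open B" "A \<union> B = ball 0 1" using \<delta> by (auto simp: A_def B_def open_Diff)
  have uA: "u z = D z" if "z \<in> A" for z using that by (simp add: u_def A_def)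
  have uB: "u z = L z" if "z \<in> B" for z using that DL by (simp add: u_def B_def)
  have DC: "C2_on D (ball 0 1)" unfolding D_def by (rule C2_on_disc_log_density) auto
  have "C2_on u (A \<union> B)"
  proof (rule C2_on_Un)
    show "C2_on u A"
      by (rule C2_on_cong[OF AB(1) uA[symmetric] C2_on_subset[OF DC]]) (use \<delta> in \<open>auto simp: A_def\<close>)
    show "C2_on u B"
    proof (rule C2_on_cong[OF AB(2) uB[symmetric]])
      show "C2_on L B"
        unfolding L_def B_def by (rule C2_on_cylindrical_log_density[OF g(1) g(2) g(3) g(4)])
    qed
  qed (use AB in auto)
  then have uC: "C2_on u (ball 0 1)" by (simp add: AB(3))
  define \<rho> where "\<rho> z = exp (u z)" for z
  show thesis
  proof
    have "\<rho> z = hyp_density z" if "r \<le> norm z" "norm z < 1" for z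
    proof -
      have n: "0 < norm z" "ln (norm z) < 0" using that r ln_less_zero[of "norm z"] by linarith+
      have "- ln (norm z) \<le> a" using that r n ln_le_cancel_iff[of r "norm z"] by (simp add: a_def)
      moreover have "\<not> norm z < \<delta>" using \<delta>_iff[of z] calculation a n by auto
      ultimately have "u z = - ln (norm z) - ln (- ln (norm z))"
        by (simp add: u_def L_def cylindrical_log_density_def g(5))
      then show ?thesis using n by (simp add: \<rho>_def hyp_density_def exp_diff exp_minus inverse_eq_divide)
    qed
    with uC show "conformal_completion r \<rho>"
      unfolding conformal_completion_def \<rho>_def by blast
  next
    fix z :: complex assume z: "z \<in> ball 0 1"
    have "\<exists>K. \<bar>K - 1\<bar> \<le> 1000 * a\<^sup>2 \<and> laplacian u z = K * exp (2 * u z)"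
    proof (cases "z \<in> A")
      case True
      have "laplacian u z = laplacian D z" by (rule laplacian_cong[OF AB(1) True uA])
      also have "\<dots> = 1 * exp (2 * D z)" unfolding D_def by (rule laplacian_disc_log_density) (use z in auto)
      finally show ?thesis using uA[OF True] by (intro exI[of _ 1]) simp
    next
      case False
      then have zB: "z \<in> B" using z AB(3) by blast
      define s where "s = - ln (norm z)"
      have s: "0 < s" using zB by (simp add: B_def s_def)
      have "laplacian u z = laplacian L z" by (rule laplacian_cong[OF AB(2) zB uB])
      also have "\<dots> = ((g' s)\<^sup>2 - g s * g'' s) * exp (2 * L z)"
        unfolding L_def
        by (rule laplacian_cylindrical_log_density[OF g(1) g(2) g(3) g(4) zB[unfolded B_def] s_def])
      finally show ?thesis using uB[OF zB] g(7)[OF s] by auto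
    qed
    then obtain K where K: "\<bar>K - 1\<bar> \<le> 1000 * a\<^sup>2" "laplacian u z = K * exp (2 * u z)" by blast
    have "gauss_curvature \<rho> z = - K"
      using gauss_curvature_exp[OF open_UNIV UNIV_I, of \<rho> u z] K(2) by (simp add: \<rho>_def)
    then have "gauss_curvature \<rho> z + 1 = - (K - 1)" by simp
    then show "\<bar>gauss_curvature \<rho> z + 1\<bar> \<le> 1000 * (ln r)\<^sup>2"
      using K(1) unfolding a_def by (simp only: abs_minus_cancel power2_minus)
  qed
qed

text \<open>What remains is to translate \<open>- ln r\<close> into \<open>1 - r\<close>: always \<open>1 - r \<le> - ln r\<close>, and \<open>- ln r \<le> 2 * (1 - r)\<close> once
  \<open>r \<ge> 1 / 2\<close>. For (i), \<open>1 - r < sqrt \<epsilon> / 100\<close> gives \<open>1000 * (ln r)\<^sup>2 \<le> 2 / 5 * \<epsilon>\<close>, which is below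
  \<open>1 - 1 / (1 + \<epsilon>) \<ge> \<epsilon> / 2\<close>. For (ii), \<open>(ln r)\<^sup>2 \<le> 1 - 1 / (1 + \<epsilon>) < \<epsilon>\<close> gives the constant 1.\<close>
theorem theorem2:
  shows "\<exists>C1 C2 :: real. C1 > 0 \<and> C2 > 0 \<and>
    (\<forall>\<epsilon> r :: real. 0 < \<epsilon> \<and> \<epsilon> < 1 \<and> 0 < r \<and> r < 1 \<and> r > 1 - C1 * sqrt \<epsilon> \<longrightarrow>
      (\<exists>\<rho>. conformal_completion r \<rho> \<and>
        (\<forall>z\<in>ball 0 1. - (1 + \<epsilon>) < gauss_curvature \<rho> z \<and>
                       gauss_curvature \<rho> z < - (1 / (1 + \<epsilon>))))) \<and>
    (\<exists>\<epsilon>0>0. \<forall>\<epsilon> r :: real. 0 < \<epsilon> \<and> \<epsilon> < \<epsilon>0 \<and> 0 < r \<and> r < 1 \<and>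
      (\<exists>\<rho>. conformal_completion r \<rho> \<and>
        (\<forall>z\<in>ball 0 1. gauss_curvature \<rho> z < - (1 / (1 + \<epsilon>)))) \<longrightarrow>
      r > 1 - C2 * sqrt \<epsilon>)"
proof (rule exI[of _ "1 / 100"], rule exI[of _ 1], intro conjI)
  show "\<forall>\<epsilon> r :: real. 0 < \<epsilon> \<and> \<epsilon> < 1 \<and> 0 < r \<and> r < 1 \<and> r > 1 - 1 / 100 * sqrt \<epsilon> \<longrightarrow>
      (\<exists>\<rho>. conformal_completion r \<rho> \<and>
        (\<forall>z\<in>ball 0 1. - (1 + \<epsilon>) < gauss_curvature \<rho> z \<and>
                       gauss_curvature \<rho> z < - (1 / (1 + \<epsilon>))))"
  proof (intro allI impI)
    fix \<epsilon> r :: real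
    assume H: "0 < \<epsilon> \<and> \<epsilon> < 1 \<and> 0 < r \<and> r < 1 \<and> r > 1 - 1 / 100 * sqrt \<epsilon>"
    then have r: "0 < r" "r < 1" and e: "0 < \<epsilon>" "\<epsilon> < 1" and *: "1 - r < sqrt \<epsilon> / 100" by auto
    have "sqrt \<epsilon> < 1" using e by simp
    then have r2: "1 / 2 < r" using * by linarith
    have "- ln r \<le> 1 / r - 1"
      using ln_le_minus_one[of "1 / r"] r by (simp add: ln_div)
    also have "\<dots> = (1 - r) / r" using r by (simp add: field_simps)
    also have "\<dots> \<le> 2 * (1 - r)" using r2 r mult_right_mono[of 1 "2 * r" "1 - r"] by (simp add: field_simps)
    finally have a: "- ln r \<le> sqrt \<epsilon> / 50" using * by simp
    then obtain \<rho> where \<rho>: "conformal_completion r \<rho>"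
      "\<And>z. z \<in> ball 0 1 \<Longrightarrow> \<bar>gauss_curvature \<rho> z + 1\<bar> \<le> 1000 * (ln r)\<^sup>2"
      using exists_completion[OF r] \<open>sqrt \<epsilon> < 1\<close> by auto
    have "(- ln r)\<^sup>2 \<le> (sqrt \<epsilon> / 50)\<^sup>2" using a r by (intro power_mono) auto
    then have b: "1000 * (ln r)\<^sup>2 \<le> 2 / 5 * \<epsilon>" using e by (simp add: power_divide)
    have c: "1 / (1 + \<epsilon>) < 1 - 2 / 5 * \<epsilon>"
    proof -
      have "\<epsilon> * \<epsilon> < \<epsilon> * 1" using e by (intro mult_strict_left_mono) auto
      then have "1 < (1 - 2 / 5 * \<epsilon>) * (1 + \<epsilon>)" using e by (simp add: algebra_simps)
      then show ?thesis using e by (simp add: pos_divide_less_eq)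
    qed
    show "\<exists>\<rho>. conformal_completion r \<rho> \<and> (\<forall>z\<in>ball 0 1. - (1 + \<epsilon>) < gauss_curvature \<rho> z \<and>
             gauss_curvature \<rho> z < - (1 / (1 + \<epsilon>)))"
    proof (intro exI[of _ \<rho>] conjI ballI \<rho>(1))
      fix z :: complex assume "z \<in> ball 0 1"
      then have "\<bar>gauss_curvature \<rho> z + 1\<bar> \<le> 2 / 5 * \<epsilon>" using \<rho>(2) b by fastforce
      then show "- (1 + \<epsilon>) < gauss_curvature \<rho> z" "gauss_curvature \<rho> z < - (1 / (1 + \<epsilon>))"
        using c e by linarith+
    qed
  qed
next
  show "\<exists>\<epsilon>0>0. \<forall>\<epsilon> r :: real. 0 < \<epsilon> \<and> \<epsilon> < \<epsilon>0 \<and> 0 < r \<and> r < 1 \<and>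
      (\<exists>\<rho>. conformal_completion r \<rho> \<and>
        (\<forall>z\<in>ball 0 1. gauss_curvature \<rho> z < - (1 / (1 + \<epsilon>)))) \<longrightarrow>
      r > 1 - 1 * sqrt \<epsilon>"
  proof (intro exI[of _ "1 :: real"] conjI allI impI)
    fix \<epsilon> r :: real
    assume H: "0 < \<epsilon> \<and> \<epsilon> < 1 \<and> 0 < r \<and> r < 1 \<and>
      (\<exists>\<rho>. conformal_completion r \<rho> \<and> (\<forall>z\<in>ball 0 1. gauss_curvature \<rho> z < - (1 / (1 + \<epsilon>))))"
    then obtain \<rho> where "conformal_completion r \<rho>"
      "\<And>z. z \<in> ball 0 1 \<Longrightarrow> gauss_curvature \<rho> z \<le> - (1 / (1 + \<epsilon>))" by force
    then have "(ln r)\<^sup>2 \<le> 1 - 1 / (1 + \<epsilon>)"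
      using completion_radius_bound[of "1 / (1 + \<epsilon>)" r \<rho>] H by auto
    also have "\<dots> < \<epsilon>"
    proof -
      have "1 - 1 / (1 + \<epsilon>) = \<epsilon> / (1 + \<epsilon>)" using H by (simp add: field_simps)
      also have "\<dots> < \<epsilon> / 1" using H by (intro divide_strict_left_mono) auto
      finally show ?thesis by simp
    qed
    finally have "sqrt ((- ln r)\<^sup>2) < sqrt \<epsilon>" by (intro real_sqrt_less_mono) simp
    then have "- ln r < sqrt \<epsilon>" using H by (subst (asm) real_sqrt_abs) auto
    moreover have "ln r \<le> r - 1" using H by (simp add: ln_le_minus_one)
    ultimately show "r > 1 - 1 * sqrt \<epsilon>" by simp
  qed simp
qed auto

end
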